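(* Let $Z\in\mathbb R^{r\times r}$ be a doubly nonnegative matrix with positive diagonal whose kernel is a rational subspace of $\mathbb R^r$. Then for every sufficiently large integer $k$, the matrix $Z\otimes J_{2k}$ is the optimal dual slack of an exact nonnegatively weighted Max-Cut instance (on $2kr$ vertices) whose optimal cut sign vectors span the entire kernel $\ker(Z\otimes J_{2k})$. Furthermore, replication preserves rank, complete positivity, and cp-rank when finite: $\operatorname{rank}(Z\otimes J_{2k})=\operatorname{rank}Z$; the matrix $Z\otimes J_{2k}$ is completely positive if and only if $Z$ is; and when these matrices are completely positive their cp-ranks are equal.
   Context: $J_m$ is the $m\times m$ all-ones matrix and $\otimes$ is the Kronecker product. A subspace of $\mathbb R^r$ is rational if it has a basis of rational vectors (the zero subspace is rational). A symmetric matrix is doubly nonnegative if it is positive semidefinite and entrywise nonnegative. It is completely positive if it can be written $N^\top N$ with $N$ entrywise nonnegative; its cp-rank is then the smallest number of rows of such an $N$. A (nonnegatively weighted) Max-Cut instance on $n\ge2$ vertices is a symmetric entrywise nonnegative $W\in\mathbb R^{n\times n}$ with zero diagonal; its support graph on $\{1,\dots,n\}$ has edges $\{i,j\}$ with $W_{ij}>0$ and is assumed to have no isolated vertices. Put $\operatorname{MC}(W)=\max_{x\in\{-1,1\}^n}\frac14\sum_{i\ne j}W_{ij}(1-x_ix_j)$ and $\operatorname{SDP}(W)=\max\{\frac14\sum_{i\ne j}W_{ij}(1-X_{ij}):X\succeq0,\ X_{ii}=1\ \forall i\}$. The instance is exact if $\operatorname{MC}(W)=\operatorname{SDP}(W)$.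 An optimal cut sign vector is an $x\in\{-1,1\}^n$ attaining $\operatorname{MC}(W)$. With $\delta_i=\sum_jW_{ij}$ and $L_W=\operatorname{Diag}(\delta)-W$, the dual problem is $\min\{\mathbf 1^\top s: Z(s)=\operatorname{Diag}(s)-\frac14L_W\succeq0\}$. For an exact instance the dual optimal solution $s$ is unique, and the corresponding $Z(s)$ is called the optimal dual slack. *)

theory Defs
  imports "Jordan_Normal_Form.Matrix_Kernel" "Jordan_Normal_Form.DL_Rank"
begin

abbreviation vec_span :: "nat \<Rightarrow> real vec set \<Rightarrow> real vec set" where
  "vec_span n \<equiv> LinearCombinations.module.span class_ring (module_vec TYPE(real) n)"

abbreviation vec_lin_indpt :: "nat \<Rightarrow> real vec set \<Rightarrow> bool" where
  "vec_lin_indpt n B \<equiv> \<not> LinearCombinations.module.lin_dep class_ring (module_vec TYPE(real) n) B"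

definition rational_subspace :: "nat \<Rightarrow> real vec set \<Rightarrow> bool" where
  "rational_subspace n V \<longleftrightarrow>
     (\<exists>B \<subseteq> carrier_vec n. (\<forall>b \<in> B. \<forall>i < n. b $ i \<in> \<rat>) \<and> vec_lin_indpt n B \<and> vec_span n B = V)"

definition all_ones :: "nat \<Rightarrow> real mat" where
  "all_ones m = mat m m (\<lambda>_. 1)"

definition kron :: "real mat \<Rightarrow> real mat \<Rightarrow> real mat" where
  "kron A B = mat (dim_row A * dim_row B) (dim_col A * dim_col B)
     (\<lambda>(i, j). A $$ (i div dim_row B, j div dim_col B) * B $$ (i mod dim_row B, j mod dim_col B))"

definition symmetric_mat :: "real mat \<Rightarrow> bool" where
  "symmetric_mat A \<longleftrightarrow> A\<^sup>T = A"

definition nonneg_mat :: "real mat \<Rightarrow> bool" where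
  "nonneg_mat A \<longleftrightarrow> (\<forall>i < dim_row A. \<forall>j < dim_col A. 0 \<le> A $$ (i, j))"

definition psd_mat :: "real mat \<Rightarrow> bool" where
  "psd_mat A \<longleftrightarrow> symmetric_mat A \<and> (\<forall>v \<in> carrier_vec (dim_row A). 0 \<le> v \<bullet> (A *\<^sub>v v))"

definition doubly_nonneg :: "real mat \<Rightarrow> bool" where
  "doubly_nonneg A \<longleftrightarrow> psd_mat A \<and> nonneg_mat A"

definition cp_factorization :: "real mat \<Rightarrow> real mat \<Rightarrow> bool" where
  "cp_factorization A N \<longleftrightarrow> nonneg_mat N \<and> A = N\<^sup>T * N"

definition completely_positive :: "real mat \<Rightarrow> bool" where
  "completely_positive A \<longleftrightarrow> (\<exists>N. cp_factorization A N)"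

text \<open>Meaningful only for completely positive matrices.\<close>

definition cp_rank :: "real mat \<Rightarrow> nat" where
  "cp_rank A = (LEAST m. \<exists>N. cp_factorization A N \<and> dim_row N = m)"

text \<open>Vertices are numbered from 0, so the vertex set is \<open>{0..<n}\<close>.\<close>

definition support_edges :: "real mat \<Rightarrow> nat set set" where
  "support_edges W = {{i, j} | i j. i < dim_row W \<and> j < dim_row W \<and> 0 < W $$ (i, j)}"

definition maxcut_instance :: "nat \<Rightarrow> real mat \<Rightarrow> bool" where
  "maxcut_instance n W \<longleftrightarrow>
     2 \<le> n \<and> W \<in> carrier_mat n n \<and> symmetric_mat W \<and> nonneg_mat W \<and>
     (\<forall>i < n. W $$ (i, i) = 0) \<and> (\<forall>i < n. \<exists>e \<in> support_edges W. i \<in> e)"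

definition sign_vecs :: "nat \<Rightarrow> real vec set" where
  "sign_vecs n = {x \<in> carrier_vec n. \<forall>i < n. x $ i \<in> {-1, 1}}"

text \<open>The sums run over ordered pairs \<open>(i, j)\<close>, so every edge is counted twice.\<close>

definition cut_value :: "real mat \<Rightarrow> real vec \<Rightarrow> real" where
  "cut_value W x =
     1 / 4 * (\<Sum>i < dim_row W. \<Sum>j \<in> {..<dim_row W} - {i}. W $$ (i, j) * (1 - x $ i * x $ j))"

definition MC :: "real mat \<Rightarrow> real" where
  "MC W = Max (cut_value W ` sign_vecs (dim_row W))"

definition sdp_value :: "real mat \<Rightarrow> real mat \<Rightarrow> real" where
  "sdp_value W X =
     1 / 4 * (\<Sum>i < dim_row W. \<Sum>j \<in> {..<dim_row W} - {i}. W $$ (i, j) * (1 - X $$ (i, j)))"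

definition elliptope :: "nat \<Rightarrow> real mat set" where
  "elliptope n = {X \<in> carrier_mat n n. psd_mat X \<and> (\<forall>i < n. X $$ (i, i) = 1)}"

text \<open>
  The elliptope is nonempty and compact and the objective is continuous, so the maximum exists;
  \<open>Max\<close> is not available because the set of values is infinite.
\<close>

definition SDP :: "real mat \<Rightarrow> real" where
  "SDP W = (GREATEST v. v \<in> sdp_value W ` elliptope (dim_row W))"

definition exact_instance :: "nat \<Rightarrow> real mat \<Rightarrow> bool" where
  "exact_instance n W \<longleftrightarrow> maxcut_instance n W \<and> MC W = SDP W"

definition optimal_cuts :: "real mat \<Rightarrow> real vec set" where
  "optimal_cuts W = {x \<in> sign_vecs (dim_row W). cut_value W x = MC W}"

definition laplacian :: "real mat \<Rightarrow> real mat" where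
  "laplacian W = mat_diag (dim_row W) (\<lambda>i. \<Sum>j < dim_row W. W $$ (i, j)) - W"

definition dual_slack :: "real mat \<Rightarrow> real vec \<Rightarrow> real mat" where
  "dual_slack W s = mat_diag (dim_row W) (\<lambda>i. s $ i) - (1 / 4) \<cdot>\<^sub>m laplacian W"

definition dual_feasible :: "real mat \<Rightarrow> real vec \<Rightarrow> bool" where
  "dual_feasible W s \<longleftrightarrow> s \<in> carrier_vec (dim_row W) \<and> psd_mat (dual_slack W s)"

definition dual_optimal :: "real mat \<Rightarrow> real vec \<Rightarrow> bool" where
  "dual_optimal W s \<longleftrightarrow> dual_feasible W s \<and>
     (\<forall>t. dual_feasible W t \<longrightarrow> (\<Sum>i < dim_row W. s $ i) \<le> (\<Sum>i < dim_row W. t $ i))"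

text \<open>
  The optimal dual slack presupposes a unique dual optimal solution, so uniqueness is part of
  the definition.
\<close>

definition is_optimal_dual_slack :: "real mat \<Rightarrow> real mat \<Rightarrow> bool" where
  "is_optimal_dual_slack W S \<longleftrightarrow>
     (\<exists>s. dual_optimal W s \<and> (\<forall>t. dual_optimal W t \<longrightarrow> t = s) \<and> S = dual_slack W s)"

end

theory Submission
  imports Defs
begin

text \<open>
  Write \<open>M = Z \<otimes> J\<close> with \<open>J\<close> the all-ones matrix of size \<open>m = 2k\<close>. Its off-diagonal entries, times
  four, are the weights of a Max-Cut instance, and its row sums are dual variables whose slack is
  \<open>M\<close>. The value of a cut \<open>x\<close> then equals the dual value minus \<open>x \<bullet> M x\<close>, and similarly for every
  feasible point of the relaxation with the trace inner product. Since \<open>M\<close> is positive semidefinite,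
  a single sign vector in its kernel proves optimality of everything involved, forces the dual
  solution to be unique, and identifies the optimal cuts with the sign vectors in the kernel of \<open>M\<close>
  (lemmas \<open>exact_if_cut_in_slack_kernel\<close> and \<open>maxcut_of_slack_realises\<close>).

  The matrix \<open>M\<close> sees a vector only through its block sums: \<open>v\<close> lies in the kernel of \<open>M\<close> exactly
  when the vector of block sums of \<open>v\<close> lies in the kernel of \<open>Z\<close> (lemma \<open>mat_kernel_kron_all_ones\<close>).
  The block sums of sign vectors are the vectors of even integers between \<open>-2k\<close> and \<open>2k\<close>. Zero is
  always among them, so sign vectors in the kernel exist; exchanging two opposite signs in a block
  shows that they span all vectors with zero block sums. If the kernel of \<open>Z\<close> is rational, it has a
  basis of integral vectors, and as soon as \<open>k\<close> bounds their entries, each basis vector is half the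
  block sum vector of a sign vector. Together these span the kernel of \<open>M\<close> (lemma \<open>span_kernel_signs\<close>).

  Rank and complete positivity are insensitive to replication because \<open>M\<close> arises from \<open>Z\<close> by
  repeating rows and columns, and contains \<open>Z\<close> as a principal submatrix.
\<close>

section \<open>Positive semidefinite matrices as Gram matrices\<close>

lemma quadratic_form_eq_sum:
  fixes A :: "real mat"
  assumes "A \<in> carrier_mat n n" "v \<in> carrier_vec n"
  shows "v \<bullet> (A *\<^sub>v v) = (\<Sum>i<n. \<Sum>j<n. v $ i * A $$ (i, j) * v $ j)"
  using assms by (auto simp: scalar_prod_def lessThan_atLeast0 sum_distrib_left mult.assoc intro!: sum.cong)

text \<open>
  Cholesky elimination, one index at a time: with \<open>d = A n n\<close>, subtracting the rank-one matrix
  \<open>A n i * A n j / d\<close> clears the last row and leaves a form that is again nonnegative, because its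
  value at \<open>v\<close> is the minimum of the old form over all choices of the last coordinate. If \<open>d = 0\<close>
  the last row already vanishes, and the convention \<open>x / 0 = 0\<close> makes the same formula correct.
\<close>

lemma gram_decomposition_fun:
  fixes A :: "nat \<Rightarrow> nat \<Rightarrow> real"
  assumes sym: "\<And>i j. i < n \<Longrightarrow> j < n \<Longrightarrow> A i j = A j i"
    and psd: "\<And>v. 0 \<le> (\<Sum>i<n. \<Sum>j<n. v i * A i j * v j)"
  shows "\<exists>f. \<forall>i<n. \<forall>j<n. A i j = (\<Sum>l<n. f l i * f l j)"
  using assms
proof (induction n arbitrary: A)
  case 0
  then show ?case by simp
next
  case (Suc n)
  define d where "d = A n n"
  define L where "L v = (\<Sum>i<n. A n i * v i)" for v :: "nat \<Rightarrow> real"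
  define Q where "Q v = (\<Sum>i<n. \<Sum>j<n. v i * A i j * v j)" for v :: "nat \<Rightarrow> real"
  have sym_n: "A i n = A n i" if "i < n" for i
    using Suc.prems(1)[of i n] that by simp
  have expand: "0 \<le> Q v + 2 * t * L v + t\<^sup>2 * d" for v t
  proof -
    let ?v = "v(n := t)"
    have "(\<Sum>i<Suc n. \<Sum>j<Suc n. ?v i * A i j * ?v j)
        = (\<Sum>i<n. (\<Sum>j<n. v i * A i j * v j) + v i * A i n * t) + ((\<Sum>j<n. t * A n j * v j) + t * A n n * t)"
      by simp
    also have "\<dots> = Q v + (\<Sum>i<n. v i * A i n * t) + ((\<Sum>j<n. t * A n j * v j) + t * A n n * t)"
      by (simp add: Q_def sum.distrib)
    also have "(\<Sum>i<n. v i * A i n * t) = t * L v"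
      unfolding L_def sum_distrib_left by (intro sum.cong) (auto simp: sym_n)
    also have "(\<Sum>j<n. t * A n j * v j) = t * L v"
      unfolding L_def sum_distrib_left by (intro sum.cong) auto
    finally have "(\<Sum>i<Suc n. \<Sum>j<Suc n. ?v i * A i j * ?v j) = Q v + 2 * t * L v + t\<^sup>2 * d"
      by (simp add: d_def power2_eq_square)
    with Suc.prems(2)[of ?v] show ?thesis by simp
  qed
  have d: "d \<ge> 0"
    using expand[of "\<lambda>_. 0" 1] by (simp add: Q_def L_def)
  have zero_row: "A n i = 0" if "d = 0" "i < n" for i
  proof (rule ccontr)
    assume nz: "A n i \<noteq> 0"
    define v :: "nat \<Rightarrow> real" where "v j = (if j = i then 1 else 0)" for j
    have L: "L v = A n i"
      using that by (simp add: L_def v_def if_distrib cong: if_cong)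
    (* A form that is linear in t takes negative values; this t gives the value -1. *)
    show False
      using expand[of v "- (Q v + 1) / (2 * L v)"] nz that by (simp add: L field_simps)
  qed
  (* The Schur complement of the last diagonal entry. *)
  define B where "B i j = A i j - A n i * A n j / d" for i j
  have "0 \<le> (\<Sum>i<n. \<Sum>j<n. v i * B i j * v j)" for v
  proof -
    have "(\<Sum>i<n. \<Sum>j<n. v i * B i j * v j)
        = (\<Sum>i<n. \<Sum>j<n. v i * A i j * v j - (A n i * v i) * (A n j * v j) / d)"
      by (intro sum.cong) (auto simp: B_def algebra_simps)
    also have "\<dots> = Q v - L v * L v / d"
      by (simp add: Q_def L_def sum_subtractf sum_product sum_divide_distrib)
    also have "\<dots> \<ge> 0"
      using expand[of v 0] expand[of v "- L v / d"] d
      by (cases "d = 0") (auto simp: power2_eq_square field_simps)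
    finally show ?thesis .
  qed
  moreover have "B i j = B j i" if "i < n" "j < n" for i j
    using Suc.prems(1)[of i j] that by (simp add: B_def)
  ultimately obtain f where f: "\<forall>i<n. \<forall>j<n. B i j = (\<Sum>l<n. f l i * f l j)"
    using Suc.IH[of B] by blast
  define g where "g l i = (if l = n then A n i / sqrt d else if i < n then f l i else 0)" for l i
  have "A i j = (\<Sum>l<Suc n. g l i * g l j)" if "i < Suc n" "j < Suc n" for i j
  proof -
    have "(\<Sum>l<n. g l i * g l j) = (if i < n \<and> j < n then B i j else 0)"
      using f by (auto simp: g_def)
    moreover have "g n i * g n j = A n i * A n j / d"
      using d by (simp add: g_def)
    moreover have "A n i * A n n / d = A n i" if "i < Suc n" for i
      using zero_row[of i] that d_def by (cases "d = 0"; cases "i = n") auto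
    ultimately show ?thesis
      using that sym_n d_def by (auto simp: B_def less_Suc_eq)
  qed
  then show ?case by blast
qed

lemma psd_gram_decomposition:
  assumes "psd_mat A" "A \<in> carrier_mat n n"
  obtains f :: "nat \<Rightarrow> nat \<Rightarrow> real"
  where "\<And>i j. i < n \<Longrightarrow> j < n \<Longrightarrow> A $$ (i, j) = (\<Sum>l<n. f l i * f l j)"
proof -
  have "A $$ (i, j) = A $$ (j, i)" if "i < n" "j < n" for i j
    using assms that unfolding psd_mat_def symmetric_mat_def
    by (metis carrier_matD index_transpose_mat(1))
  moreover have "0 \<le> (\<Sum>i<n. \<Sum>j<n. v i * A $$ (i, j) * v j)" for v
    using assms quadratic_form_eq_sum[of A n "vec n v"] vec_carrier[of n v]
    by (simp add: psd_mat_def) (metis (no_types, lifting) vec_carrier)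
  ultimately show ?thesis
    using gram_decomposition_fun[of n "\<lambda>i j. A $$ (i, j)"] that by blast
qed

text \<open>
  Writing \<open>X\<close> as a sum of terms \<open>f f\<^sup>T\<close> turns the trace inner product into a sum of values
  \<open>f \<bullet> A f\<close> of the other form. This is what makes the dual bound valid.
\<close>

lemma psd_inner_nonneg:
  assumes A: "psd_mat A" "A \<in> carrier_mat n n" and X: "psd_mat X" "X \<in> carrier_mat n n"
  shows "0 \<le> (\<Sum>i<n. \<Sum>j<n. A $$ (i, j) * X $$ (i, j))"
proof -
  obtain f where f: "\<And>i j. i < n \<Longrightarrow> j < n \<Longrightarrow> X $$ (i, j) = (\<Sum>l<n. f l i * f l j)"
    using psd_gram_decomposition[OF X] by blast
  have "(\<Sum>i<n. \<Sum>j<n. A $$ (i, j) * X $$ (i, j))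
      = (\<Sum>i<n. \<Sum>j<n. \<Sum>l<n. f l i * A $$ (i, j) * f l j)"
    by (intro sum.cong) (auto simp: f sum_distrib_left mult_ac)
  also have "\<dots> = (\<Sum>i<n. \<Sum>l<n. \<Sum>j<n. f l i * A $$ (i, j) * f l j)"
    by (rule sum.cong[OF refl], rule sum.swap)
  also have "\<dots> = (\<Sum>l<n. \<Sum>i<n. \<Sum>j<n. f l i * A $$ (i, j) * f l j)"
    by (rule sum.swap)
  also have "\<dots> = (\<Sum>l<n. vec n (f l) \<bullet> (A *\<^sub>v vec n (f l)))"
    using A by (intro sum.cong refl) (simp add: quadratic_form_eq_sum)
  also have "\<dots> \<ge> 0"
    using A by (intro sum_nonneg) (auto simp: psd_mat_def)
  finally show ?thesis .
qed

text \<open>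
  In Gram form \<open>v \<bullet> A v\<close> is a sum of squares \<open>(f \<bullet> v)\<^sup>2\<close>. If it vanishes, every \<open>f \<bullet> v\<close> does,
  and \<open>A v\<close> is the combination of the vectors \<open>f\<close> with these coefficients.
\<close>

lemma psd_form_zero_iff:
  assumes A: "psd_mat A" "A \<in> carrier_mat n n" and v: "v \<in> carrier_vec n"
  shows "v \<bullet> (A *\<^sub>v v) = 0 \<longleftrightarrow> A *\<^sub>v v = 0\<^sub>v n"
proof
  assume form: "v \<bullet> (A *\<^sub>v v) = 0"
  obtain f where f: "\<And>i j. i < n \<Longrightarrow> j < n \<Longrightarrow> A $$ (i, j) = (\<Sum>l<n. f l i * f l j)"
    using psd_gram_decomposition[OF A] by blast
  have "v \<bullet> (A *\<^sub>v v) = (\<Sum>i<n. \<Sum>j<n. \<Sum>l<n. (f l i * v $ i) * (f l j * v $ j))"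
    using A v by (simp add: quadratic_form_eq_sum f sum_distrib_left sum_distrib_right mult_ac)
  also have "\<dots> = (\<Sum>i<n. \<Sum>l<n. \<Sum>j<n. (f l i * v $ i) * (f l j * v $ j))"
    by (rule sum.cong[OF refl], rule sum.swap)
  also have "\<dots> = (\<Sum>l<n. \<Sum>i<n. \<Sum>j<n. (f l i * v $ i) * (f l j * v $ j))"
    by (rule sum.swap)
  also have "\<dots> = (\<Sum>l<n. (\<Sum>i<n. f l i * v $ i)\<^sup>2)"
    by (simp add: power2_eq_square sum_product)
  finally have "(\<Sum>l<n. (\<Sum>i<n. f l i * v $ i)\<^sup>2) = 0"
    using form by simp
  then have zero: "(\<Sum>i<n. f l i * v $ i) = 0" if "l < n" for l
    using that by (subst (asm) sum_nonneg_eq_0_iff) auto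
  show "A *\<^sub>v v = 0\<^sub>v n"
  proof (intro eq_vecI)
    fix i assume "i < dim_vec (0\<^sub>v n :: real vec)"
    then have i: "i < n" by simp
    have "(A *\<^sub>v v) $ i = (\<Sum>j<n. \<Sum>l<n. f l i * (f l j * v $ j))"
      using A v i by (auto simp: scalar_prod_def lessThan_atLeast0 f sum_distrib_right mult.assoc intro!: sum.cong)
    also have "\<dots> = (\<Sum>l<n. f l i * (\<Sum>j<n. f l j * v $ j))"
      by (subst sum.swap) (simp add: sum_distrib_left)
    finally show "(A *\<^sub>v v) $ i = 0\<^sub>v n $ i"
      using zero i by simp
  qed (use A in auto)
qed (use v in simp)

section \<open>Certifying exactness by a dual slack\<close>

text \<open>
  For unit diagonal, \<open>Diag t\<close> contributes exactly the sum of \<open>t\<close> to the trace inner product with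
  \<open>X\<close>, and the Laplacian contributes the objective. So the distance of the objective from a dual
  value is the inner product of \<open>X\<close> with the slack, whatever \<open>t\<close> is.
\<close>

lemma sdp_value_eq_dual_gap:
  assumes W: "W \<in> carrier_mat n n" and X: "X \<in> carrier_mat n n"
    and diag: "\<And>i. i < n \<Longrightarrow> X $$ (i, i) = 1"
  shows "sdp_value W X =
    (\<Sum>i<n. t $ i) - (\<Sum>i<n. \<Sum>j<n. dual_slack W t $$ (i, j) * X $$ (i, j))"
proof -
  have row: "(\<Sum>j<n. dual_slack W t $$ (i, j) * X $$ (i, j))
      = t $ i - 1 / 4 * (\<Sum>j \<in> {..<n} - {i}. W $$ (i, j) * (1 - X $$ (i, j)))" if i: "i < n" for i
  proof -
    have "(\<Sum>j<n. dual_slack W t $$ (i, j) * X $$ (i, j))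
        = dual_slack W t $$ (i, i) * X $$ (i, i) + (\<Sum>j \<in> {..<n} - {i}. dual_slack W t $$ (i, j) * X $$ (i, j))"
      using i by (simp add: sum.remove)
    also have "dual_slack W t $$ (i, i) * X $$ (i, i) = t $ i - 1 / 4 * ((\<Sum>j<n. W $$ (i, j)) - W $$ (i, i))"
      using W i diag by (simp add: dual_slack_def laplacian_def mat_diag_def)
    also have "(\<Sum>j<n. W $$ (i, j)) = W $$ (i, i) + (\<Sum>j \<in> {..<n} - {i}. W $$ (i, j))"
      using i by (simp add: sum.remove)
    also have "(\<Sum>j \<in> {..<n} - {i}. dual_slack W t $$ (i, j) * X $$ (i, j))
        = 1 / 4 * (\<Sum>j \<in> {..<n} - {i}. W $$ (i, j) * X $$ (i, j))"
      unfolding sum_distrib_left using W i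
      by (intro sum.cong) (auto simp: dual_slack_def laplacian_def mat_diag_def)
    finally show ?thesis
      by (simp add: right_diff_distrib sum_subtractf)
  qed
  have "(\<Sum>i<n. \<Sum>j<n. dual_slack W t $$ (i, j) * X $$ (i, j))
      = (\<Sum>i<n. t $ i - 1 / 4 * (\<Sum>j \<in> {..<n} - {i}. W $$ (i, j) * (1 - X $$ (i, j))))"
    by (intro sum.cong refl row) simp
  then show ?thesis
    using W by (simp add: sdp_value_def sum_subtractf sum_distrib_left)
qed

lemma dual_slack_carrier [simp]: "W \<in> carrier_mat n n \<Longrightarrow> dual_slack W t \<in> carrier_mat n n"
  by (auto simp: dual_slack_def laplacian_def mat_diag_def)

lemma weak_duality:
  assumes W: "W \<in> carrier_mat n n" and t: "dual_feasible W t" and X: "X \<in> elliptope n"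
  shows "sdp_value W X \<le> (\<Sum>i<n. t $ i)"
proof -
  have "0 \<le> (\<Sum>i<n. \<Sum>j<n. dual_slack W t $$ (i, j) * X $$ (i, j))"
    using assms by (intro psd_inner_nonneg) (auto simp: dual_feasible_def elliptope_def)
  then show ?thesis
    using sdp_value_eq_dual_gap[of W n X t] W X by (auto simp: elliptope_def)
qed

text \<open>
  The matrix \<open>x x\<^sup>T\<close>, by which a cut becomes a feasible point of the semidefinite relaxation.
\<close>

definition sign_gram :: "real vec \<Rightarrow> real mat" where
  "sign_gram x = mat (dim_vec x) (dim_vec x) (\<lambda>(i, j). x $ i * x $ j)"

lemma sign_vecsD:
  assumes "x \<in> sign_vecs n"
  shows "x \<in> carrier_vec n" "i < n \<Longrightarrow> x $ i = 1 \<or> x $ i = -1" "i < n \<Longrightarrow> x $ i * x $ i = 1"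
  using assms by (auto simp: sign_vecs_def)

lemma sign_gram_in_elliptope:
  assumes "x \<in> sign_vecs n"
  shows "sign_gram x \<in> elliptope n"
proof -
  have x: "dim_vec x = n"
    using sign_vecsD[OF assms] by simp
  have "0 \<le> v \<bullet> (sign_gram x *\<^sub>v v)" if v: "v \<in> carrier_vec n" for v
  proof -
    have "v \<bullet> (sign_gram x *\<^sub>v v) = (\<Sum>i<n. \<Sum>j<n. (v $ i * x $ i) * (v $ j * x $ j))"
      using v x by (subst quadratic_form_eq_sum) (auto simp: sign_gram_def mult_ac)
    also have "\<dots> = (\<Sum>i<n. v $ i * x $ i)\<^sup>2"
      by (simp add: power2_eq_square sum_product)
    finally show ?thesis by simp
  qed
  then have "psd_mat (sign_gram x)"
    using x by (auto simp: psd_mat_def symmetric_mat_def sign_gram_def mult.commute)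
  then show ?thesis
    using x sign_vecsD(3)[OF assms] by (auto simp: elliptope_def sign_gram_def)
qed

lemma cut_value_eq_sdp_value:
  assumes "W \<in> carrier_mat n n" "x \<in> carrier_vec n"
  shows "cut_value W x = sdp_value W (sign_gram x)"
  using assms by (simp add: cut_value_def sdp_value_def sign_gram_def)

lemma cut_value_eq_dual_gap:
  assumes W: "W \<in> carrier_mat n n" and x: "x \<in> sign_vecs n"
  shows "cut_value W x = (\<Sum>i<n. t $ i) - x \<bullet> (dual_slack W t *\<^sub>v x)"
proof -
  have "cut_value W x =
      (\<Sum>i<n. t $ i) - (\<Sum>i<n. \<Sum>j<n. dual_slack W t $$ (i, j) * sign_gram x $$ (i, j))"
    using W sign_vecsD(1)[OF x] sign_gram_in_elliptope[OF x]
    by (subst cut_value_eq_sdp_value[OF W], simp, subst sdp_value_eq_dual_gap[OF W])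
       (auto simp: elliptope_def)
  also have "(\<Sum>i<n. \<Sum>j<n. dual_slack W t $$ (i, j) * sign_gram x $$ (i, j))
      = x \<bullet> (dual_slack W t *\<^sub>v x)"
    using W sign_vecsD(1)[OF x]
    by (subst quadratic_form_eq_sum[of _ n]) (auto simp: sign_gram_def mult_ac)
  finally show ?thesis .
qed

text \<open>
  The gap between a cut and a dual value is \<open>x \<bullet> S x\<close> for the slack \<open>S\<close>, and for a positive
  semidefinite \<open>S\<close> this vanishes only on the kernel.
\<close>

lemma complementary_slackness:
  assumes W: "W \<in> carrier_mat n n" and t: "dual_feasible W t" and x: "x \<in> sign_vecs n"
  shows "cut_value W x = (\<Sum>i<n. t $ i) \<longleftrightarrow> dual_slack W t *\<^sub>v x = 0\<^sub>v n"
  using cut_value_eq_dual_gap[OF W x, of t] psd_form_zero_iff[of "dual_slack W t" n x]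
    W t sign_vecsD(1)[OF x]
  by (auto simp: dual_feasible_def)

lemma finite_sign_vecs: "finite (sign_vecs n)"
proof -
  have "sign_vecs n \<subseteq> vec_of_list ` {xs. set xs \<subseteq> {-1, 1} \<and> length xs = n}"
  proof
    fix x assume "x \<in> sign_vecs n"
    then show "x \<in> vec_of_list ` {xs. set xs \<subseteq> {-1, 1} \<and> length xs = n}"
      by (intro image_eqI[of _ _ "list_of_vec x"])
         (auto simp: sign_vecs_def vec_list in_set_conv_nth list_of_vec_index)
  qed
  then show ?thesis
    by (rule finite_subset) (intro finite_imageI finite_lists_length_eq, simp)
qed

text \<open>
  One sign vector in the kernel of one feasible slack closes every gap at once: its cut value meets
  the dual value, which bounds both maxima, so its rank-one matrix attains the maximum of the
  relaxation. Any other dual optimum must also annihilate this sign vector,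
  and two slacks of the same instance differ only on the diagonal.
\<close>

lemma exact_if_cut_in_slack_kernel:
  assumes inst: "maxcut_instance n W" and s: "dual_feasible W s"
    and x: "x \<in> sign_vecs n" and ker: "dual_slack W s *\<^sub>v x = 0\<^sub>v n"
  shows "exact_instance n W" "is_optimal_dual_slack W (dual_slack W s)"
    "optimal_cuts W = sign_vecs n \<inter> mat_kernel (dual_slack W s)"
proof -
  have W: "W \<in> carrier_mat n n"
    using inst by (simp add: maxcut_instance_def)
  have dim: "dim_row W = n"
    using W by simp
  define \<mu> where "\<mu> = (\<Sum>i<n. s $ i)"
  have cut: "cut_value W x = \<mu>"
    using complementary_slackness[OF W s x] ker by (simp add: \<mu>_def)
  have sdp: "sdp_value W X \<le> \<mu>" if "X \<in> elliptope n" for X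
    using weak_duality[OF W s that] by (simp add: \<mu>_def)
  have cut_eq: "cut_value W y = sdp_value W (sign_gram y)" if "y \<in> sign_vecs n" for y
    using cut_value_eq_sdp_value[OF W] sign_vecsD(1)[OF that] by simp
  have "SDP W = \<mu>"
    unfolding SDP_def dim using cut cut_eq[OF x] sign_gram_in_elliptope[OF x] sdp
    by (intro Greatest_equality) (auto intro!: image_eqI[of _ _ "sign_gram x"])
  moreover have MC: "MC W = \<mu>"
    unfolding MC_def dim using cut cut_eq sign_gram_in_elliptope sdp x finite_sign_vecs
    by (intro Max_eqI) (auto intro!: image_eqI[of _ _ x])
  ultimately show "exact_instance n W"
    using inst by (simp add: exact_instance_def)
  show "optimal_cuts W = sign_vecs n \<inter> mat_kernel (dual_slack W s)"
    using complementary_slackness[OF W s] sign_vecsD(1) mat_kernel[OF dual_slack_carrier[OF W, of s]]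
    by (auto simp: optimal_cuts_def dim MC \<mu>_def)
  have bound: "\<mu> \<le> (\<Sum>i<n. t $ i)" if "dual_feasible W t" for t
    using weak_duality[OF W that sign_gram_in_elliptope[OF x]] cut cut_eq[OF x] by simp
  have optimal: "dual_optimal W s"
    using s bound by (auto simp: dual_optimal_def dim \<mu>_def)
  have "t = s" if t: "dual_optimal W t" for t
  proof (rule eq_vecI)
    have feas: "dual_feasible W t" and "(\<Sum>i<n. t $ i) \<le> \<mu>"
      using t s by (auto simp: dual_optimal_def dim \<mu>_def)
    with bound[of t] cut have "cut_value W x = (\<Sum>i<n. t $ i)"
      by simp
    then have ker_t: "dual_slack W t *\<^sub>v x = 0\<^sub>v n"
      using complementary_slackness[OF W feas x] by simp
    have carr: "s \<in> carrier_vec n" "t \<in> carrier_vec n"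
      using s feas by (auto simp: dual_feasible_def dim)
    then show "dim_vec t = dim_vec s" by simp
    fix i assume "i < dim_vec s"
    then have i: "i < n" using carr by simp
    (* Row i of (slack of u) x = 0 reads u i * x i = c with c independent of u, and x i is nonzero. *)
    define c where "c = (\<Sum>j<n. 1 / 4 * laplacian W $$ (i, j) * x $ j)"
    have entry: "(dual_slack W u *\<^sub>v x) $ i = u $ i * x $ i - c" for u
    proof -
      have "(dual_slack W u *\<^sub>v x) $ i = (\<Sum>j<n. dual_slack W u $$ (i, j) * x $ j)"
        using i sign_vecsD(1)[OF x] carrier_matD[OF dual_slack_carrier[OF W, of u]]
        by (auto simp: scalar_prod_def lessThan_atLeast0 intro!: sum.cong)
      also have "\<dots> = (\<Sum>j<n. (if i = j then u $ i * x $ i else 0) - 1 / 4 * laplacian W $$ (i, j) * x $ j)"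
        using W i by (intro sum.cong) (auto simp: dual_slack_def laplacian_def mat_diag_def left_diff_distrib)
      also have "\<dots> = u $ i * x $ i - c"
        using i by (simp add: sum_subtractf c_def)
      finally show ?thesis .
    qed
    have "0 = s $ i * x $ i - c" "0 = t $ i * x $ i - c"
      using entry[of s, unfolded ker] entry[of t, unfolded ker_t] i by auto
    then have "t $ i * x $ i = s $ i * x $ i"
      by linarith
    then show "t $ i = s $ i"
      using sign_vecsD(2)[OF x i] by auto
  qed
  with optimal show "is_optimal_dual_slack W (dual_slack W s)"
    unfolding is_optimal_dual_slack_def by blast
qed

text \<open>
  A slack has off-diagonal entries \<open>W $$ (i, j) / 4\<close>, hence the factor 4. The diagonal of \<open>M\<close> is
  absorbed by the dual variables.
\<close>

definition maxcut_of_slack :: "real mat \<Rightarrow> real mat" where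
  "maxcut_of_slack M = mat (dim_row M) (dim_row M) (\<lambda>(i, j). if i = j then 0 else 4 * M $$ (i, j))"

text \<open>
  Apart from its diagonal, a nonnegative matrix is a weight matrix up to scaling, and taking its row
  sums as dual variables restores the diagonal. A sign vector in the kernel is then the only thing
  missing for the certificate.
\<close>

lemma maxcut_of_slack_realises:
  assumes n: "2 \<le> n" and M: "M \<in> carrier_mat n n" and dnn: "doubly_nonneg M"
    and nbr: "\<forall>i<n. \<exists>j<n. j \<noteq> i \<and> 0 < M $$ (i, j)"
    and x: "x \<in> sign_vecs n" "M *\<^sub>v x = 0\<^sub>v n"
  shows "exact_instance n (maxcut_of_slack M)"
    "is_optimal_dual_slack (maxcut_of_slack M) M"
    "optimal_cuts (maxcut_of_slack M) = sign_vecs n \<inter> mat_kernel M"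
proof -
  let ?W = "maxcut_of_slack M"
  define s where "s = vec n (\<lambda>i. \<Sum>j<n. M $$ (i, j))"
  have W: "?W \<in> carrier_mat n n"
    using M by (simp add: maxcut_of_slack_def)
  have W_entry: "?W $$ (i, j) = (if i = j then 0 else 4 * M $$ (i, j))" if "i < n" "j < n" for i j
    using that M by (simp add: maxcut_of_slack_def)
  have sym: "M $$ (i, j) = M $$ (j, i)" if "i < n" "j < n" for i j
    using dnn M that unfolding doubly_nonneg_def psd_mat_def symmetric_mat_def
    by (metis carrier_matD index_transpose_mat(1))
  have nonneg: "0 \<le> M $$ (i, j)" if "i < n" "j < n" for i j
    using dnn M that by (auto simp: doubly_nonneg_def nonneg_mat_def)
  have "\<exists>e \<in> support_edges ?W. i \<in> e" if i: "i < n" for i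
  proof -
    obtain j where j: "j < n" "j \<noteq> i" "0 < M $$ (i, j)"
      using nbr i by blast
    then have "i < dim_row ?W \<and> j < dim_row ?W \<and> 0 < ?W $$ (i, j)"
      using W W_entry[OF i j(1)] i by auto
    then have "{i, j} \<in> support_edges ?W"
      unfolding support_edges_def by blast
    then show ?thesis by blast
  qed
  moreover have "symmetric_mat ?W"
    unfolding symmetric_mat_def using M sym by (auto simp: maxcut_of_slack_def)
  ultimately have inst: "maxcut_instance n ?W"
    using n W nonneg by (auto simp: maxcut_instance_def nonneg_mat_def W_entry)
  have slack: "dual_slack ?W s = M"
  proof (rule eq_matI)
    fix i j assume "i < dim_row M" "j < dim_col M"
    then have ij: "i < n" "j < n" using M by auto
    have "(\<Sum>j<n. ?W $$ (i, j)) = (\<Sum>j<n. 4 * M $$ (i, j) - (if i = j then 4 * M $$ (i, i) else 0))"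
      using ij by (intro sum.cong) (auto simp: W_entry)
    also have "\<dots> = 4 * (s $ i - M $$ (i, i))"
      using ij by (simp add: sum_subtractf s_def sum_distrib_left)
    finally show "dual_slack ?W s $$ (i, j) = M $$ (i, j)"
      using ij W by (auto simp: dual_slack_def laplacian_def mat_diag_def W_entry diff_divide_distrib)
  qed (use M carrier_matD[OF dual_slack_carrier[OF W, of s]] in auto)
  have feas: "dual_feasible ?W s"
    using dnn W slack by (simp add: dual_feasible_def doubly_nonneg_def s_def)
  note realise = exact_if_cut_in_slack_kernel[OF inst feas x(1), unfolded slack, OF x(2)]
  show "exact_instance n ?W" "is_optimal_dual_slack ?W M"
    "optimal_cuts ?W = sign_vecs n \<inter> mat_kernel M"
    by (rule realise)+
qed

section \<open>Replicating a matrix\<close>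

lemma kron_all_ones:
  assumes "Z \<in> carrier_mat r c" "0 < m"
  shows "kron Z (all_ones m) = mat (r * m) (c * m) (\<lambda>(i, j). Z $$ (i div m, j div m))"
  using assms by (auto simp: kron_def all_ones_def intro!: eq_matI)

lemma kron_all_ones_carrier:
  assumes "Z \<in> carrier_mat r c" "0 < m"
  shows "kron Z (all_ones m) \<in> carrier_mat (r * m) (c * m)"
  using kron_all_ones[OF assms] by simp

text \<open>
  The index \<open>j\<close> of a replicated vector belongs to block \<open>j div m\<close>, matching the index convention of
  \<^const>\<open>kron\<close>. If \<open>E\<^sup>T\<close> denotes this linear map, then \<open>Z \<otimes> J = E Z E\<^sup>T\<close>.
\<close>

definition block_sums :: "nat \<Rightarrow> nat \<Rightarrow> real vec \<Rightarrow> real vec" where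
  "block_sums r m v = vec r (\<lambda>a. \<Sum>j \<in> {a * m..<a * m + m}. v $ j)"

lemma div_block_less: "i < r * m \<Longrightarrow> i div m < (r :: nat)"
  by (simp add: less_mult_imp_div_less)

lemma block_index_less: "j < a * m + m \<Longrightarrow> a < r \<Longrightarrow> j < r * (m :: nat)"
  by (metis add.commute less_le_trans mult_Suc mult_le_mono1 Suc_leI)

lemma sum_over_blocks:
  fixes g :: "nat \<Rightarrow> real"
  shows "(\<Sum>j<r * m. g (j div m) * v $ j) = (\<Sum>a<r. g a * block_sums r m v $ a)"
proof -
  have "(\<Sum>j<r * m. g (j div m) * v $ j)
      = (\<Sum>a<r. \<Sum>j \<in> {a * m..<a * m + m}. g (j div m) * v $ j)"
    by (rule sum.nat_group[symmetric])
  also have "\<dots> = (\<Sum>a<r. \<Sum>j \<in> {a * m..<a * m + m}. g a * v $ j)"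
    by (intro sum.cong refl) (auto intro!: arg_cong[of _ _ g] div_nat_eqI simp: mult.commute)
  also have "\<dots> = (\<Sum>a<r. g a * block_sums r m v $ a)"
    by (simp add: block_sums_def sum_distrib_left)
  finally show ?thesis .
qed

lemma kron_all_ones_mult_vec:
  assumes Z: "Z \<in> carrier_mat r r" and m: "0 < m" and v: "v \<in> carrier_vec (r * m)" and i: "i < r * m"
  shows "(kron Z (all_ones m) *\<^sub>v v) $ i = (Z *\<^sub>v block_sums r m v) $ (i div m)"
proof -
  have "(kron Z (all_ones m) *\<^sub>v v) $ i = (\<Sum>j<r * m. Z $$ (i div m, j div m) * v $ j)"
    using v i by (simp add: kron_all_ones[OF Z m] scalar_prod_def lessThan_atLeast0)
  also have "\<dots> = (\<Sum>a<r. Z $$ (i div m, a) * block_sums r m v $ a)"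
    by (rule sum_over_blocks)
  also have "\<dots> = (Z *\<^sub>v block_sums r m v) $ (i div m)"
    using Z div_block_less[OF i] by (simp add: scalar_prod_def lessThan_atLeast0 block_sums_def)
  finally show ?thesis .
qed

lemma mat_kernel_kron_all_ones:
  assumes Z: "Z \<in> carrier_mat r r" and m: "0 < m"
  shows "v \<in> mat_kernel (kron Z (all_ones m)) \<longleftrightarrow>
    v \<in> carrier_vec (r * m) \<and> block_sums r m v \<in> mat_kernel Z"
proof (cases "v \<in> carrier_vec (r * m)")
  case v: True
  have "(\<forall>i<r * m. (kron Z (all_ones m) *\<^sub>v v) $ i = 0) \<longleftrightarrow> (\<forall>a<r. (Z *\<^sub>v block_sums r m v) $ a = 0)"
  proof (intro iffI allI impI)
    fix a assume *: "\<forall>i<r * m. (kron Z (all_ones m) *\<^sub>v v) $ i = 0" and a: "a < r"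
    have "a * m < r * m" using a m by simp
    then show "(Z *\<^sub>v block_sums r m v) $ a = 0"
      using * kron_all_ones_mult_vec[OF Z m v, of "a * m"] m by simp
  next
    fix i assume "\<forall>a<r. (Z *\<^sub>v block_sums r m v) $ a = 0" "i < r * m"
    then show "(kron Z (all_ones m) *\<^sub>v v) $ i = 0"
      using kron_all_ones_mult_vec[OF Z m v] div_block_less by simp
  qed
  then show ?thesis
    using v Z kron_all_ones_carrier[OF Z m]
    by (auto simp: mat_kernel_def vec_eq_iff block_sums_def)
next
  case False
  then show ?thesis
    using mat_kernel_carrier[OF kron_all_ones_carrier[OF Z m]] by blast
qed

lemma doubly_nonneg_kron_all_ones:
  assumes Z: "Z \<in> carrier_mat r r" and m: "0 < m" and dnn: "doubly_nonneg Z"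
  shows "doubly_nonneg (kron Z (all_ones m))"
proof -
  have sym: "Z $$ (a, b) = Z $$ (b, a)" if "a < r" "b < r" for a b
    using dnn Z that unfolding doubly_nonneg_def psd_mat_def symmetric_mat_def
    by (metis carrier_matD index_transpose_mat(1))
  have "0 \<le> v \<bullet> (kron Z (all_ones m) *\<^sub>v v)" if v: "v \<in> carrier_vec (r * m)" for v
  proof -
    have "v \<bullet> (kron Z (all_ones m) *\<^sub>v v)
        = (\<Sum>i<r * m. (Z *\<^sub>v block_sums r m v) $ (i div m) * v $ i)"
      using v kron_all_ones_carrier[OF Z m] kron_all_ones_mult_vec[OF Z m v]
      unfolding scalar_prod_def by (auto simp: lessThan_atLeast0 mult.commute intro!: sum.cong simp del: index_mult_mat_vec)
    also have "\<dots> = block_sums r m v \<bullet> (Z *\<^sub>v block_sums r m v)"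
      unfolding sum_over_blocks using Z by (simp add: scalar_prod_def lessThan_atLeast0 mult.commute)
    also have "\<dots> \<ge> 0"
      using dnn Z by (auto simp: doubly_nonneg_def psd_mat_def block_sums_def)
    finally show ?thesis .
  qed
  moreover have "symmetric_mat (kron Z (all_ones m))"
    unfolding symmetric_mat_def kron_all_ones[OF Z m]
    by (rule eq_matI) (auto simp: sym div_block_less)
  moreover have "nonneg_mat (kron Z (all_ones m))"
    using dnn Z unfolding kron_all_ones[OF Z m]
    by (auto simp: doubly_nonneg_def nonneg_mat_def div_block_less)
  ultimately show ?thesis
    using kron_all_ones_carrier[OF Z m] by (auto simp: doubly_nonneg_def psd_mat_def)
qed

section \<open>Complete positivity\<close>

text \<open>
  Repeating every column of a factor of \<open>Z\<close> gives a factor of the replicated matrix; picking one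
  column from each block goes back, since \<open>Z\<close> is a principal submatrix of its replication. Neither
  operation changes the number of rows, so the attainable row numbers agree.
\<close>

lemma cp_factorization_kron_all_ones:
  assumes Z: "Z \<in> carrier_mat r r" and m: "0 < m"
  shows "(\<exists>N. cp_factorization (kron Z (all_ones m)) N \<and> dim_row N = d)
     \<longleftrightarrow> (\<exists>N. cp_factorization Z N \<and> dim_row N = d)"
proof (intro iffI; elim exE conjE)
  fix N assume N: "cp_factorization (kron Z (all_ones m)) N" "dim_row N = d"
  define N' where "N' = mat d r (\<lambda>(l, a). N $$ (l, a * m))"
  have eq: "kron Z (all_ones m) = N\<^sup>T * N"
    using N by (simp add: cp_factorization_def)
  have col: "dim_col N = r * m"
    using arg_cong[OF eq, of dim_row] kron_all_ones_carrier[OF Z m] by simp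
  have "Z = N'\<^sup>T * N'"
  proof (rule eq_matI)
    fix a b assume "a < dim_row (N'\<^sup>T * N')" "b < dim_col (N'\<^sup>T * N')"
    then have ab: "a < r" "b < r" by (auto simp: N'_def)
    then have abm: "a * m < r * m" "b * m < r * m" using m by auto
    have "Z $$ (a, b) = kron Z (all_ones m) $$ (a * m, b * m)"
      using abm m by (simp add: kron_all_ones[OF Z m])
    also have "\<dots> = (N'\<^sup>T * N') $$ (a, b)"
      unfolding eq using ab abm col N by (simp add: N'_def scalar_prod_def)
    finally show "Z $$ (a, b) = (N'\<^sup>T * N') $$ (a, b)" .
  qed (use Z in \<open>auto simp: N'_def\<close>)
  moreover have "nonneg_mat N'"
    using N col m by (auto simp: cp_factorization_def nonneg_mat_def N'_def)
  ultimately show "\<exists>N. cp_factorization Z N \<and> dim_row N = d"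
    by (intro exI[of _ N']) (simp add: cp_factorization_def, simp add: N'_def)
next
  fix N assume N: "cp_factorization Z N" "dim_row N = d"
  define N' where "N' = mat d (r * m) (\<lambda>(l, i). N $$ (l, i div m))"
  have eq: "Z = N\<^sup>T * N"
    using N by (simp add: cp_factorization_def)
  have col: "dim_col N = r"
    using arg_cong[OF eq, of dim_row] Z by simp
  have "kron Z (all_ones m) = N'\<^sup>T * N'"
    unfolding kron_all_ones[OF Z m]
  proof (rule eq_matI)
    fix i j assume "i < dim_row (N'\<^sup>T * N')" "j < dim_col (N'\<^sup>T * N')"
    then have ij: "i < r * m" "j < r * m" by (auto simp: N'_def)
    have "Z $$ (i div m, j div m) = (N'\<^sup>T * N') $$ (i, j)"
      unfolding eq using ij col N div_block_less[OF ij(1)] div_block_less[OF ij(2)]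
      by (simp add: N'_def scalar_prod_def)
    then show "mat (r * m) (r * m) (\<lambda>(i, j). Z $$ (i div m, j div m)) $$ (i, j) = (N'\<^sup>T * N') $$ (i, j)"
      using ij by simp
  qed (auto simp: N'_def)
  moreover have "nonneg_mat N'"
    using N col by (auto simp: cp_factorization_def nonneg_mat_def N'_def div_block_less)
  ultimately show "\<exists>N. cp_factorization (kron Z (all_ones m)) N \<and> dim_row N = d"
    by (intro exI[of _ N']) (simp add: cp_factorization_def, simp add: N'_def)
qed

lemma completely_positive_kron_all_ones:
  assumes "Z \<in> carrier_mat r r" "0 < m"
  shows "completely_positive (kron Z (all_ones m)) \<longleftrightarrow> completely_positive Z"
    and "cp_rank (kron Z (all_ones m)) = cp_rank Z"
  using cp_factorization_kron_all_ones[OF assms]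
  by (auto simp: completely_positive_def cp_rank_def)

section \<open>Spans of real vectors\<close>

lemma vec_span_memberE:
  assumes B: "B \<subseteq> carrier_vec n" and u: "u \<in> vec_span n B"
  obtains A c where "finite A" "A \<subseteq> B" "\<And>i. i < n \<Longrightarrow> u $ i = (\<Sum>b\<in>A. c b * b $ i)"
proof -
  interpret vec_space "TYPE(real)" n .
  obtain c A where "finite A" "A \<subseteq> B" "u = lincomb c A"
    using in_spanE[OF u] by blast
  then show thesis
    using B that[of A c] lincomb_index[of _ A c] by auto
qed

lemma vec_span_subset_mat_kernel:
  assumes M: "M \<in> carrier_mat nr n" and S: "S \<subseteq> mat_kernel M"
  shows "vec_span n S \<subseteq> mat_kernel M"
proof
  interpret vec_space "TYPE(real)" n .
  fix u assume u: "u \<in> vec_span n S"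
  have S': "S \<subseteq> carrier_vec n"
    using S mat_kernel_carrier[OF M] by blast
  obtain A c where A: "finite A" "A \<subseteq> S" "\<And>i. i < n \<Longrightarrow> u $ i = (\<Sum>b\<in>A. c b * b $ i)"
    using vec_span_memberE[OF S' u] by blast
  have u': "u \<in> carrier_vec n"
    using u span_closed[OF S'] by simp
  have "(M *\<^sub>v u) $ i = 0" if i: "i < nr" for i
  proof -
    have "(M *\<^sub>v u) $ i = (\<Sum>j<n. \<Sum>b\<in>A. c b * (M $$ (i, j) * b $ j))"
      using M i u' A(3) by (simp add: scalar_prod_def lessThan_atLeast0 sum_distrib_left mult_ac)
    also have "\<dots> = (\<Sum>b\<in>A. c b * (\<Sum>j<n. M $$ (i, j) * b $ j))"
      by (subst sum.swap) (simp add: sum_distrib_left)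
    also have "\<dots> = (\<Sum>b\<in>A. c b * (M *\<^sub>v b) $ i)"
    proof (intro sum.cong refl arg_cong2[of _ _ _ _ "(*)"])
      fix b assume "b \<in> A"
      then have "b \<in> carrier_vec n" using A S' by blast
      then show "(\<Sum>j<n. M $$ (i, j) * b $ j) = (M *\<^sub>v b) $ i"
        using M i by (simp add: scalar_prod_def lessThan_atLeast0)
    qed
    also have "\<dots> = 0"
      using A S mat_kernelD(2)[OF M] i by (intro sum.neutral) auto
    finally show ?thesis .
  qed
  then show "u \<in> mat_kernel M"
    using M u' by (intro mat_kernelI) (auto intro!: eq_vecI)
qed

lemma vec_span_closed_sum:
  assumes S: "S \<subseteq> carrier_vec n" and "finite I" and f: "\<And>i. i \<in> I \<Longrightarrow> f i \<in> vec_span n S"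
    and u: "u \<in> carrier_vec n" "\<And>j. j < n \<Longrightarrow> u $ j = (\<Sum>i\<in>I. c i * f i $ j)"
  shows "u \<in> vec_span n S"
proof -
  interpret vec_space "TYPE(real)" n .
  have "vec n (\<lambda>j. \<Sum>i\<in>I. c i * f i $ j) \<in> span S"
    using assms(2) f
  proof (induction I)
    case empty
    have "vec n (\<lambda>j. 0) = (0\<^sub>v n :: real vec)" by auto
    then show ?case
      using in_spanI[of "0\<^sub>v n" "\<lambda>_. 0" "{}" S] by (simp add: lincomb_def)
  next
    case (insert i I)
    have fi: "f i \<in> carrier_vec n"
      using insert.prems[of i] span_closed[OF S] by simp
    have "vec n (\<lambda>j. \<Sum>i\<in>insert i I. c i * f i $ j)
        = c i \<cdot>\<^sub>v f i + vec n (\<lambda>j. \<Sum>i\<in>I. c i * f i $ j)"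
      using insert.hyps fi by (intro eq_vecI) auto
    moreover have "c i \<cdot>\<^sub>v f i \<in> span S"
      using insert.prems by (intro smult_in_span S) auto
    moreover have "vec n (\<lambda>j. \<Sum>i\<in>I. c i * f i $ j) \<in> span S"
      using insert by auto
    ultimately show ?case
      using S by (simp add: span_add1)
  qed
  moreover have "u = vec n (\<lambda>j. \<Sum>i\<in>I. c i * f i $ j)"
    using u by (intro eq_vecI) auto
  ultimately show ?thesis by simp
qed

section \<open>Balanced sign patterns span the replicated kernel\<close>

text \<open>
  In each block \<open>a\<close> the first \<open>k + z a\<close> of the \<open>2 * k\<close> signs are positive and the others negative, so
  that the block sum is \<open>2 * z a\<close> as long as \<open>\<bar>z a\<bar> \<le> k\<close>.
\<close>

definition threshold_signs :: "nat \<Rightarrow> nat \<Rightarrow> (nat \<Rightarrow> int) \<Rightarrow> real vec" where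
  "threshold_signs r k z =
     vec (r * (2 * k)) (\<lambda>i. if int (i mod (2 * k)) < int k + z (i div (2 * k)) then 1 else -1)"

lemma threshold_signs_in_sign_vecs: "threshold_signs r k z \<in> sign_vecs (r * (2 * k))"
  by (auto simp: threshold_signs_def sign_vecs_def)

lemma sum_threshold:
  assumes "c \<le> m"
  shows "(\<Sum>p<m. if p < c then 1 else -1 :: real) = 2 * real c - real m"
proof -
  have "(\<Sum>p<m. if p < c then 1 else -1 :: real) = (\<Sum>p<m. 2 * (if p < c then 1 else 0) - 1)"
    by (intro sum.cong) auto
  also have "\<dots> = 2 * (\<Sum>p<m. if p < c then 1 else 0) - real m"
    by (simp add: sum_subtractf sum_distrib_left)
  also have "(\<Sum>p<m. if p < c then 1 else 0 :: real) = (\<Sum>p<c. 1)"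
    using assms by (intro sum.mono_neutral_cong_right) auto
  finally show ?thesis by simp
qed

lemma block_sums_threshold_signs:
  assumes k: "1 \<le> k" and z: "\<And>a. a < r \<Longrightarrow> \<bar>z a\<bar> \<le> int k" and a: "a < r"
  shows "block_sums r (2 * k) (threshold_signs r k z) $ a = 2 * of_int (z a)"
proof -
  let ?m = "2 * k"
  have "block_sums r ?m (threshold_signs r k z) $ a
      = (\<Sum>j \<in> {0 + a * ?m..<?m + a * ?m}. threshold_signs r k z $ j)"
    using a by (simp add: block_sums_def add.commute)
  also have "\<dots> = (\<Sum>p \<in> {0..<?m}. threshold_signs r k z $ (p + a * ?m))"
    by (rule sum.shift_bounds_nat_ivl)
  also have "\<dots> = (\<Sum>p<?m. if p < nat (int k + z a) then 1 else -1)"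
  proof (intro sum.cong)
    fix p assume "p \<in> {..<?m}"
    then have p: "p < ?m" by simp
    have "p + a * ?m < r * ?m"
      using p a by (intro block_index_less[of _ a]) auto
    moreover have "(p + a * ?m) div ?m = a" "(p + a * ?m) mod ?m = p"
      using p k by auto
    ultimately show "threshold_signs r k z $ (p + a * ?m) = (if p < nat (int k + z a) then 1 else -1)"
      unfolding threshold_signs_def by (auto simp: zless_nat_eq_int_zless)
  qed auto
  also have "\<dots> = 2 * real (nat (int k + z a)) - real ?m"
    using z[OF a] by (intro sum_threshold) linarith
  also have "\<dots> = 2 * of_int (z a)"
    using z[OF a] by (simp add: of_nat_nat)
  finally show ?thesis .
qed

text \<open>
  An even block length allows equally many signs of both kinds in every block. Such a vector exists
  even when \<open>Z\<close> is nonsingular, and it makes the constructed instance exact.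
\<close>

lemma balanced_signs_in_kernel:
  assumes Z: "Z \<in> carrier_mat r r" and k: "1 \<le> k"
  shows "threshold_signs r k (\<lambda>_. 0) \<in> mat_kernel (kron Z (all_ones (2 * k)))"
proof -
  have "block_sums r (2 * k) (threshold_signs r k (\<lambda>_. 0)) = 0\<^sub>v r"
    using block_sums_threshold_signs[OF k, of r "\<lambda>_. 0"]
    by (intro eq_vecI) (auto simp: block_sums_def)
  moreover have "0\<^sub>v r \<in> mat_kernel Z"
    using Z by (intro mat_kernelI) auto
  ultimately show ?thesis
    using k sign_vecsD(1)[OF threshold_signs_in_sign_vecs] by (simp add: mat_kernel_kron_all_ones[OF Z])
qed

lemma mem_block_iff:
  assumes "0 < (m :: nat)"
  shows "l \<in> {a * m..<a * m + m} \<longleftrightarrow> l div m = a"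
proof
  assume "l div m = a"
  then show "l \<in> {a * m..<a * m + m}"
    using dividend_less_div_times[OF assms, of l] div_times_less_eq_dividend[of l m] by auto
qed (auto intro: div_nat_eqI simp: mult.commute)

text \<open>
  Exchanging two opposite signs inside one block keeps the block sums, hence membership in the
  kernel, and changes the sign vector by a nonzero multiple of the difference of two unit vectors.
\<close>

lemma unit_diff_in_span:
  assumes Z: "Z \<in> carrier_mat r r" and m: "0 < m"
    and x: "x \<in> sign_vecs (r * m) \<inter> mat_kernel (kron Z (all_ones m))"
    and ij: "i < r * m" "j < r * m" "i div m = j div m" and opp: "x $ i = - x $ j"
  shows "unit_vec (r * m) i - unit_vec (r * m) j
    \<in> vec_span (r * m) (sign_vecs (r * m) \<inter> mat_kernel (kron Z (all_ones m)))"
    (is "_ \<in> vec_span ?n ?S")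
proof -
  interpret vec_space "TYPE(real)" ?n .
  define y where "y = vec ?n (\<lambda>l. if l = i \<or> l = j then - x $ l else x $ l)"
  have x': "x \<in> sign_vecs ?n" "x \<in> carrier_vec ?n"
    using x sign_vecsD by auto
  have ne: "i \<noteq> j"
    using opp sign_vecsD(2)[OF x'(1) ij(1)] by auto
  (* Negating two opposite signs is the same as exchanging them. *)
  have y_eq: "y $ l = x $ l - 2 * x $ i * ((if l = i then 1 else 0) - (if l = j then 1 else 0))"
    if "l < ?n" for l
    using that ne opp by (auto simp: y_def)
  have "block_sums r m y $ a = block_sums r m x $ a" if a: "a < r" for a
  proof -
    let ?I = "{a * m..<a * m + m}"
    have "(\<Sum>l\<in>?I. y $ l)
        = (\<Sum>l\<in>?I. x $ l - 2 * x $ i * ((if l = i then 1 else 0) - (if l = j then 1 else 0)))"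
      using a by (intro sum.cong refl y_eq) (auto intro: block_index_less)
    also have "\<dots> = (\<Sum>l\<in>?I. x $ l)
        - 2 * x $ i * ((\<Sum>l\<in>?I. if l = i then 1 else 0) - (\<Sum>l\<in>?I. if l = j then 1 else 0))"
      by (simp only: sum_subtractf sum_distrib_left right_diff_distrib)
    also have "(\<Sum>l\<in>?I. if l = i then 1 else 0) = (\<Sum>l\<in>?I. if l = j then 1 else (0 :: real))"
      using ij(3) by (simp add: mem_block_iff[OF m, unfolded atLeastLessThan_iff])
    finally show ?thesis using a by (simp add: block_sums_def)
  qed
  then have "block_sums r m y = block_sums r m x"
    by (intro eq_vecI) (auto simp: block_sums_def)
  then have y: "y \<in> ?S"
    using x sign_vecsD(2)[OF x'(1)] mat_kernel_kron_all_ones[OF Z m]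
    by (auto simp: y_def sign_vecs_def)
  have S: "?S \<subseteq> carrier_vec ?n"
    using sign_vecsD by auto
  define f where "f b = (if b then x else y)" for b
  show ?thesis
  proof (rule vec_span_closed_sum[OF S, of UNIV f _ "\<lambda>b. if b then x $ i / 2 else - x $ i / 2"])
    show "f b \<in> vec_span ?n ?S" for b
      using x y span_mem[OF S] by (auto simp: f_def)
    fix l assume l: "l < ?n"
    have "x $ i * x $ i = 1"
      using sign_vecsD(3)[OF x'(1) ij(1)] .
    have "(\<Sum>b\<in>UNIV. (if b then x $ i / 2 else - x $ i / 2) * f b $ l) = x $ i / 2 * (x $ l - y $ l)"
      by (simp add: UNIV_bool f_def algebra_simps)
    also have "\<dots> = (x $ i * x $ i) * ((if l = i then 1 else 0) - (if l = j then 1 else 0))"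
      unfolding y_eq[OF l] by simp
    finally show "(unit_vec ?n i - unit_vec ?n j) $ l
        = (\<Sum>b\<in>UNIV. (if b then x $ i / 2 else - x $ i / 2) * f b $ l)"
      using l ij \<open>x $ i * x $ i = 1\<close> by simp
  qed (use ij in auto)
qed

text \<open>
  A kernel vector is determined, modulo vectors with zero block sums, by its block sums, which form
  a vector of the kernel of \<open>Z\<close>. Differences of unit vectors inside blocks take care of zero block
  sums. For the rest, each spanning vector \<open>b\<close> of the kernel of \<open>Z\<close> has an integral multiple \<open>D b * b\<close>
  of size at most \<open>k\<close>, and the threshold pattern with these integers is a sign vector in the kernel
  whose block sums are \<open>2 * D b * b\<close>.
\<close>

lemma span_kernel_signs:
  assumes Z: "Z \<in> carrier_mat r r" and k: "1 \<le> k"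
    and B: "B \<subseteq> carrier_vec r" "vec_span r B = mat_kernel Z"
    and D: "\<And>b. b \<in> B \<Longrightarrow> 0 < D b"
    and z: "\<And>b a. b \<in> B \<Longrightarrow> a < r \<Longrightarrow> D b * b $ a = of_int (z b a)"
      "\<And>b a. b \<in> B \<Longrightarrow> a < r \<Longrightarrow> \<bar>z b a\<bar> \<le> int k"
  shows "vec_span (r * (2 * k)) (sign_vecs (r * (2 * k)) \<inter> mat_kernel (kron Z (all_ones (2 * k))))
    = mat_kernel (kron Z (all_ones (2 * k)))"
proof -
  define m where "m = 2 * k"
  define n where "n = r * m"
  let ?K = "mat_kernel (kron Z (all_ones m))"
  let ?S = "sign_vecs n \<inter> ?K"
  interpret R: vec_space "TYPE(real)" r .
  interpret N: vec_space "TYPE(real)" n .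
  have m: "0 < m" using k by (simp add: m_def)
  have S: "?S \<subseteq> carrier_vec n"
    using sign_vecsD by auto
  have K_iff: "v \<in> ?K \<longleftrightarrow> v \<in> carrier_vec n \<and> block_sums r m v \<in> mat_kernel Z" for v
    unfolding n_def by (rule mat_kernel_kron_all_ones[OF Z m])
  define x0 where "x0 = threshold_signs r k (\<lambda>_. 0)"
  define x where "x b = threshold_signs r k (z b)" for b
  have x0: "x0 \<in> ?S"
    using balanced_signs_in_kernel[OF Z k] threshold_signs_in_sign_vecs[of r k "\<lambda>_. 0"]
    by (simp add: x0_def n_def m_def)
  have sums_x: "block_sums r m (x b) $ a = 2 * D b * b $ a" if "b \<in> B" "a < r" for a b
    using block_sums_threshold_signs[OF k z(2)[OF that(1)] that(2)] z(1)[OF that]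
    by (simp add: x_def m_def)
  have x: "x b \<in> ?S" if b: "b \<in> B" for b
  proof -
    have "block_sums r m (x b) = (2 * D b) \<cdot>\<^sub>v b"
      using b B sums_x by (intro eq_vecI) (auto simp: block_sums_def)
    moreover have "b \<in> mat_kernel Z"
      using b B R.span_mem by blast
    moreover have "x b \<in> sign_vecs n"
      using threshold_signs_in_sign_vecs by (simp add: x_def n_def m_def)
    ultimately show ?thesis
      using sign_vecsD(1) mat_kernel_smult[OF Z] by (auto simp: K_iff)
  qed
  (* Two equal signs of x0 are linked through an entry l of the opposite sign in the same block. *)
  have unit_diff: "unit_vec n i - unit_vec n j \<in> vec_span n ?S"
    if ij: "i < n" "j < n" "i div m = j div m" for i j
  proof (cases "x0 $ i = x0 $ j")
    case False
    then have "x0 $ i = - x0 $ j"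
      using x0 sign_vecsD(2)[of x0 n i] sign_vecsD(2)[of x0 n j] ij by auto
    then show ?thesis
      using unit_diff_in_span[OF Z m x0[unfolded n_def]] ij by (simp add: n_def)
  next
    case True
    (* The first k signs of each block of x0 are positive: offset k is negative, offset 0 positive. *)
    define l where "l = i div m * m + (if x0 $ i = 1 then k else 0)"
    have div: "l div m = i div m" and mod: "l mod m = (if x0 $ i = 1 then k else 0)"
      using m k by (auto simp: l_def m_def)
    have l: "l < n"
      unfolding n_def l_def using ij k
      by (intro block_index_less[of _ "i div m"]) (auto simp: m_def n_def div_block_less)
    have x0l: "x0 $ l = - x0 $ i"
      using l mod k sign_vecsD(2)[of x0 n i] x0 ij
      by (auto simp: x0_def threshold_signs_def n_def m_def split: if_splits)
    have il: "unit_vec n i - unit_vec n l \<in> vec_span n ?S"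
      using unit_diff_in_span[OF Z m x0[unfolded n_def], of i l] ij l div x0l by (simp add: n_def)
    have jl: "unit_vec n j - unit_vec n l \<in> vec_span n ?S"
      using unit_diff_in_span[OF Z m x0[unfolded n_def], of j l] ij l div x0l True by (simp add: n_def)
    define f where "f b = (if b then unit_vec n i - unit_vec n l else unit_vec n j - unit_vec n l :: real vec)" for b
    show ?thesis
    proof (rule vec_span_closed_sum[OF S, of UNIV f _ "\<lambda>b. if b then 1 else -1"])
      show "f b \<in> vec_span n ?S" for b
        using il jl by (simp add: f_def)
    qed (use ij l in \<open>auto simp: UNIV_bool f_def\<close>)
  qed
  (* If all block sums vanish, w is the sum of w i * (e_i - e_(first index of the block of i)). *)
  have balanced: "w \<in> vec_span n ?S"
    if w: "w \<in> carrier_vec n" "\<And>a. a < r \<Longrightarrow> block_sums r m w $ a = 0" for w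
  proof (rule vec_span_closed_sum[OF S, of "{..<n}" "\<lambda>i. unit_vec n i - unit_vec n (i div m * m)" w "\<lambda>i. w $ i"])
    have base: "i div m * m < n" if "i < n" for i
      using that div_times_less_eq_dividend[of i m] by linarith
    show "unit_vec n i - unit_vec n (i div m * m) \<in> vec_span n ?S" if "i \<in> {..<n}" for i
      using that base m by (intro unit_diff) auto
    fix j assume j: "j < n"
    have "(\<Sum>i<n. w $ i * (unit_vec n i - unit_vec n (i div m * m)) $ j)
        = (\<Sum>i<n. (if i = j then w $ i else 0) - (if i div m * m = j then 1 else 0) * w $ i)"
      using j base by (intro sum.cong) (auto simp: unit_vec_def)
    also have "\<dots> = w $ j - (\<Sum>i<n. (if i div m * m = j then 1 else 0) * w $ i)"
      using j by (simp add: sum_subtractf)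
    also have "(\<Sum>i<n. (if i div m * m = j then 1 else 0) * w $ i) = 0"
      unfolding n_def by (subst sum_over_blocks) (simp add: w(2))
    finally show "w $ j = (\<Sum>i<n. w $ i * (unit_vec n i - unit_vec n (i div m * m)) $ j)"
      using j by simp
  qed (use w in auto)
  have "v \<in> vec_span n ?S" if v: "v \<in> ?K" for v
  proof -
    have v': "v \<in> carrier_vec n" "block_sums r m v \<in> vec_span r B"
      using v B by (auto simp: K_iff)
    obtain A c where A: "finite A" "A \<subseteq> B"
      and c: "\<And>a. a < r \<Longrightarrow> block_sums r m v $ a = (\<Sum>b\<in>A. c b * b $ a)"
      using vec_span_memberE[OF B(1) v'(2)] by blast
    (* The coefficients for which p has the same block sums as v. *)
    define e where "e b = c b / (2 * D b)" for b
    define p where "p = vec n (\<lambda>j. \<Sum>b\<in>A. e b * x b $ j)"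
    have p: "p \<in> vec_span n ?S"
      using A x N.span_mem[OF S]
      by (intro vec_span_closed_sum[OF S A(1), of x p e]) (auto simp: p_def)
    have "block_sums r m (v - p) $ a = 0" if a: "a < r" for a
    proof -
      let ?I = "{a * m..<a * m + m}"
      have "(v - p) $ j = v $ j - (\<Sum>b\<in>A. e b * x b $ j)" if "j \<in> ?I" for j
        using block_index_less[of j a m r] that a v' by (simp add: p_def n_def)
      then have "block_sums r m (v - p) $ a = (\<Sum>j\<in>?I. v $ j - (\<Sum>b\<in>A. e b * x b $ j))"
        using a by (simp add: block_sums_def)
      also have "\<dots> = block_sums r m v $ a - (\<Sum>j\<in>?I. \<Sum>b\<in>A. e b * x b $ j)"
        using a by (simp add: sum_subtractf block_sums_def)
      also have "(\<Sum>j\<in>?I. \<Sum>b\<in>A. e b * x b $ j) = (\<Sum>b\<in>A. e b * block_sums r m (x b) $ a)"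
        using a by (subst sum.swap) (simp add: block_sums_def sum_distrib_left)
      also have "\<dots> = (\<Sum>b\<in>A. c b * b $ a)"
      proof (intro sum.cong refl)
        fix b assume "b \<in> A"
        then have "b \<in> B" using A by blast
        then show "e b * block_sums r m (x b) $ a = c b * b $ a"
          using D[of b] a by (simp add: sums_x e_def)
      qed
      finally show ?thesis using c[OF a] by simp
    qed
    moreover have "v - p \<in> carrier_vec n"
      using v' by (simp add: p_def)
    ultimately have w: "v - p \<in> vec_span n ?S"
      by (intro balanced) auto
    define f where "f b = (if b then v - p else p)" for b
    show ?thesis
    proof (rule vec_span_closed_sum[OF S, of UNIV f _ "\<lambda>_. 1"])
      show "f b \<in> vec_span n ?S" for b
        using w p by (simp add: f_def)
    qed (use v' in \<open>auto simp: UNIV_bool f_def p_def\<close>)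
  qed
  moreover have "vec_span n ?S \<subseteq> ?K"
    using kron_all_ones_carrier[OF Z m] by (intro vec_span_subset_mat_kernel) (auto simp: n_def)
  ultimately show ?thesis
    unfolding n_def m_def by blast
qed

section \<open>Rank\<close>

lemma vec_lin_indpt_iff:
  assumes S: "S \<subseteq> carrier_vec n"
  shows "vec_lin_indpt n S \<longleftrightarrow> (\<forall>A c. finite A \<longrightarrow> A \<subseteq> S \<longrightarrow>
    (\<forall>j<n. (\<Sum>x\<in>A. c x * x $ j) = 0) \<longrightarrow> (\<forall>x\<in>A. c x = 0))"
proof -
  interpret vec_space "TYPE(real)" n .
  have "lincomb c A = 0\<^sub>v n \<longleftrightarrow> (\<forall>j<n. (\<Sum>x\<in>A. c x * x $ j) = 0)"
    if "finite A" "A \<subseteq> S" for A c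
  proof -
    have A: "A \<subseteq> carrier_vec n" using that S by blast
    have "lincomb c A \<in> carrier_vec n"
      using lincomb_closed[of A c] A by simp
    then show ?thesis
      by (auto simp: vec_eq_iff lincomb_index[OF _ A])
  qed
  then show ?thesis
    unfolding lin_dep_def by (simp add: class_field_def) blast
qed

definition replicate_vec :: "nat \<Rightarrow> nat \<Rightarrow> real vec \<Rightarrow> real vec" where
  "replicate_vec r m v = vec (r * m) (\<lambda>i. v $ (i div m))"

lemma inj_on_replicate_vec:
  assumes m: "0 < m"
  shows "inj_on (replicate_vec r m) (carrier_vec r)"
proof (rule inj_onI)
  fix u v assume uv: "u \<in> carrier_vec r" "v \<in> carrier_vec r" "replicate_vec r m u = replicate_vec r m v"
  show "u = v"
  proof (rule eq_vecI)
    fix a assume "a < dim_vec v"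
    then have "a * m < r * m" using uv m by simp
    then show "u $ a = v $ a"
      using arg_cong[OF uv(3), of "\<lambda>w. w $ (a * m)"] m by (simp add: replicate_vec_def)
  qed (use uv in simp)
qed

text \<open>
  A linear relation among replicated vectors only repeats, \<open>m\<close> times per coordinate, the relation
  among the original ones.
\<close>

lemma lin_indpt_replicate_vec:
  assumes m: "0 < m" and S: "S \<subseteq> carrier_vec r"
  shows "vec_lin_indpt (r * m) (replicate_vec r m ` S) \<longleftrightarrow> vec_lin_indpt r S"
proof -
  let ?\<rho> = "replicate_vec r m"
  have S': "?\<rho> ` S \<subseteq> carrier_vec (r * m)"
    by (auto simp: replicate_vec_def)
  have inj: "inj_on ?\<rho> S"
    using inj_on_replicate_vec[OF m] S by (rule inj_on_subset)
  have relation: "(\<forall>i<r * m. (\<Sum>y\<in>?\<rho> ` A. c y * y $ i) = 0)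
      \<longleftrightarrow> (\<forall>a<r. (\<Sum>x\<in>A. c (?\<rho> x) * x $ a) = 0)" if A: "A \<subseteq> S" for A c
  proof -
    have entry: "(\<Sum>y\<in>?\<rho> ` A. c y * y $ i) = (\<Sum>x\<in>A. c (?\<rho> x) * x $ (i div m))" if "i < r * m" for i
      using that unfolding sum.reindex[OF inj_on_subset[OF inj A]] by (simp add: replicate_vec_def)
    show ?thesis
    proof (intro iffI allI impI)
      fix a assume "\<forall>i<r * m. (\<Sum>y\<in>?\<rho> ` A. c y * y $ i) = 0" and "a < r"
      then show "(\<Sum>x\<in>A. c (?\<rho> x) * x $ a) = 0"
        using entry[of "a * m"] m by simp
    next
      fix i assume "\<forall>a<r. (\<Sum>x\<in>A. c (?\<rho> x) * x $ a) = 0" and "i < r * m"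
      then show "(\<Sum>y\<in>?\<rho> ` A. c y * y $ i) = 0"
        using entry[of i] div_block_less[of i r m] by simp
    qed
  qed
  show ?thesis
    unfolding vec_lin_indpt_iff[OF S'] vec_lin_indpt_iff[OF S]
  proof (intro iffI allI impI)
    fix A c
    assume indep: "\<forall>A c. finite A \<longrightarrow> A \<subseteq> ?\<rho> ` S \<longrightarrow>
        (\<forall>j<r * m. (\<Sum>x\<in>A. c x * x $ j) = 0) \<longrightarrow> (\<forall>x\<in>A. c x = 0)"
      and A: "finite A" "A \<subseteq> S" and zero: "\<forall>a<r. (\<Sum>x\<in>A. c x * x $ a) = 0"
    define d where "d y = c (the_inv_into S ?\<rho> y)" for y
    have d: "d (?\<rho> x) = c x" if "x \<in> A" for x
      using that A the_inv_into_f_f[OF inj] by (auto simp: d_def)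
    have "(\<Sum>x\<in>A. d (?\<rho> x) * x $ a) = (\<Sum>x\<in>A. c x * x $ a)" for a
      by (intro sum.cong) (simp_all add: d)
    then have "\<forall>i<r * m. (\<Sum>y\<in>?\<rho> ` A. d y * y $ i) = 0"
      using relation[OF A(2)] zero by simp
    then have "\<forall>y\<in>?\<rho> ` A. d y = 0"
      using indep A by blast
    then show "\<forall>x\<in>A. c x = 0"
      using d by auto
  next
    fix A' c
    assume indep: "\<forall>A c. finite A \<longrightarrow> A \<subseteq> S \<longrightarrow>
        (\<forall>j<r. (\<Sum>x\<in>A. c x * x $ j) = 0) \<longrightarrow> (\<forall>x\<in>A. c x = 0)"
      and A': "finite A'" "A' \<subseteq> ?\<rho> ` S" and zero: "\<forall>i<r * m. (\<Sum>y\<in>A'. c y * y $ i) = 0"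
    obtain A where A: "A \<subseteq> S" "A' = ?\<rho> ` A"
      using A'(2) by (auto simp: subset_image_iff)
    have "finite A"
      using A A'(1) inj by (metis finite_imageD inj_on_subset)
    moreover have "\<forall>a<r. (\<Sum>x\<in>A. c (?\<rho> x) * x $ a) = 0"
      using zero relation[OF A(1)] A(2) by simp
    ultimately have "\<forall>x\<in>A. c (?\<rho> x) = 0"
      using indep[rule_format, of A "\<lambda>x. c (?\<rho> x)"] A(1) by blast
    then show "\<forall>y\<in>A'. c y = 0"
      using A(2) by blast
  qed
qed

lemma obtain_rank_basis:
  assumes A: "A \<in> carrier_mat n nc"
  obtains S where "S \<subseteq> set (cols A)" "vec_lin_indpt n S" "vec_space.rank n A = card S"
proof -
  interpret vec_space "TYPE(real)" n .
  let ?P = "\<lambda>T. T \<subseteq> set (cols A) \<and> lin_indpt T"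
  have "?P {}"
    by (simp add: lin_dep_def)
  then obtain S where S: "maximal S ?P"
    using maximal_exists_superset[of "set (cols A)" ?P "{}"] by auto
  then show thesis
    using that[of S] rank_card_indpt[OF A S] by (auto simp: maximal_def)
qed

text \<open>
  The columns of the replicated matrix are the replicated columns of \<open>Z\<close>, each occurring \<open>m\<close>
  times, and replication of vectors is injective and preserves linear independence. So maximal
  independent sets of columns on both sides have the same size.
\<close>

lemma rank_kron_all_ones:
  assumes Z: "Z \<in> carrier_mat r r" and m: "0 < m"
  shows "vec_space.rank (r * m) (kron Z (all_ones m)) = vec_space.rank r Z"
proof (rule antisym)
  let ?M = "kron Z (all_ones m)" and ?\<rho> = "replicate_vec r m"
  have M: "?M \<in> carrier_mat (r * m) (r * m)"
    using kron_all_ones_carrier[OF Z m] .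
  have Z_cols: "set (cols Z) \<subseteq> carrier_vec r"
    using cols_dim[of Z] Z by simp
  have col: "col ?M j = ?\<rho> (col Z (j div m))" if "j < r * m" for j
    using that Z by (intro eq_vecI) (auto simp: kron_all_ones[OF Z m] replicate_vec_def div_block_less)
  have cols: "set (cols ?M) = ?\<rho> ` set (cols Z)"
  proof -
    have "(\<lambda>j. j div m) ` {..<r * m} = {..<r}"
    proof (intro equalityI subsetI)
      fix a assume "a \<in> {..<r}"
      then show "a \<in> (\<lambda>j. j div m) ` {..<r * m}"
        using m by (intro image_eqI[of _ _ "a * m"]) auto
    qed (auto simp: div_block_less)
    moreover have "set (cols ?M) = (\<lambda>j. ?\<rho> (col Z (j div m))) ` {..<r * m}"
      using M col by (auto simp: cols_def)
    moreover have "set (cols Z) = col Z ` {..<r}"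
      using Z by (auto simp: cols_def)
    moreover have "(\<lambda>j. ?\<rho> (col Z (j div m))) ` {..<r * m} = ?\<rho> ` col Z ` (\<lambda>j. j div m) ` {..<r * m}"
      by (simp only: image_image)
    ultimately show ?thesis
      by simp
  qed
  have inj: "inj_on ?\<rho> (set (cols Z))"
    using inj_on_replicate_vec[OF m] Z_cols by (rule inj_on_subset)
  show "vec_space.rank (r * m) ?M \<le> vec_space.rank r Z"
  proof -
    obtain S where S: "S \<subseteq> set (cols ?M)" "vec_lin_indpt (r * m) S" "vec_space.rank (r * m) ?M = card S"
      using obtain_rank_basis[OF M] by blast
    obtain T where T: "T \<subseteq> set (cols Z)" "S = ?\<rho> ` T"
      using S(1) unfolding cols by (auto simp: subset_image_iff)
    then have "vec_lin_indpt r T" "card S = card T"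
      using S(2) lin_indpt_replicate_vec[OF m, of T r] Z_cols inj
      by (auto intro: card_image inj_on_subset)
    then show ?thesis
      using vec_space.rank_ge_card_indpt[OF Z T(1)] S(3) by simp
  qed
  show "vec_space.rank r Z \<le> vec_space.rank (r * m) ?M"
  proof -
    obtain T where T: "T \<subseteq> set (cols Z)" "vec_lin_indpt r T" "vec_space.rank r Z = card T"
      using obtain_rank_basis[OF Z] by blast
    have "vec_lin_indpt (r * m) (?\<rho> ` T)" "card (?\<rho> ` T) = card T"
      using T(1,2) lin_indpt_replicate_vec[OF m, of T r] Z_cols inj
      by (auto intro: card_image inj_on_subset)
    moreover have "?\<rho> ` T \<subseteq> set (cols ?M)"
      using T(1) cols by blast
    ultimately show ?thesis
      using vec_space.rank_ge_card_indpt[OF M, of "?\<rho> ` T"] T(3) by simp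
  qed
qed

section \<open>Realising replicated matrices as optimal dual slacks\<close>

lemma common_denominator:
  fixes f :: "'a \<Rightarrow> 'b :: field_char_0"
  assumes "finite A" "\<And>a. a \<in> A \<Longrightarrow> f a \<in> \<rat>"
  shows "\<exists>D :: int. 0 < D \<and> (\<forall>a\<in>A. of_int D * f a \<in> \<int>)"
  using assms
proof (induction A)
  case empty
  show ?case by (intro exI[of _ 1]) simp
next
  case (insert x A)
  then obtain D :: int where D: "0 < D" "\<forall>a\<in>A. of_int D * f a \<in> \<int>"
    by auto
  obtain p q :: int where q: "0 < q" "f x = of_int p / of_int q"
    using insert.prems[of x] by (metis Rats_cases' insertI1)
  have "of_int (D * q) * f a \<in> \<int>" if "a \<in> insert x A" for a
  proof (cases "a = x")
    case True
    then have "of_int (D * q) * f a = of_int (D * p)"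
      using q by simp
    then show ?thesis by (metis Ints_of_int)
  next
    case False
    then have "of_int q * (of_int D * f a) \<in> \<int>"
      using D(2) False that by (metis Ints_mult Ints_of_int insertE)
    then show ?thesis by (simp add: mult_ac)
  qed
  then show ?case
    using D q by (intro exI[of _ "D * q"]) auto
qed

text \<open>
  Rationality of the subspace enters here: a rational basis is finite, so its vectors have integral
  multiples with a common bound, and this bound is the threshold beyond which blocks are long enough
  for sign vectors to realise all of them as block sums.
\<close>

lemma integral_multiples:
  assumes "rational_subspace r V"
  obtains B D z k0 where
    "B \<subseteq> carrier_vec r" "vec_span r B = V"
    "\<And>b. b \<in> B \<Longrightarrow> 0 < (D b :: real)"
    "\<And>b a. b \<in> B \<Longrightarrow> a < r \<Longrightarrow> D b * b $ a = of_int (z b a)"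
    "\<And>b a. b \<in> B \<Longrightarrow> a < r \<Longrightarrow> \<bar>z b a\<bar> \<le> int k0"
proof -
  interpret vec_space "TYPE(real)" r .
  obtain B where B: "B \<subseteq> carrier_vec r" "vec_span r B = V" "lin_indpt B"
    and rat: "\<And>b a. b \<in> B \<Longrightarrow> a < r \<Longrightarrow> b $ a \<in> \<rat>"
    using assms unfolding rational_subspace_def by blast
  have fin: "finite B"
    using li_le_dim(1)[OF fin_dim] B by simp
  have "\<exists>D z. 0 < (D :: real) \<and> (\<forall>a<r. D * b $ a = of_int (z a))" if b: "b \<in> B" for b
  proof -
    obtain D :: int where D: "0 < D" "\<forall>a<r. of_int D * b $ a \<in> \<int>"
      using common_denominator[of "{..<r}" "\<lambda>a. b $ a"] rat[OF b] by auto
    then have "\<forall>a<r. of_int D * b $ a = of_int \<lfloor>of_int D * b $ a\<rfloor>"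
      by simp
    moreover have "0 < (of_int D :: real)"
      using D by simp
    ultimately show ?thesis
      by (intro exI[of _ "of_int D"] exI[of _ "\<lambda>a. \<lfloor>of_int D * b $ a\<rfloor>"] conjI)
  qed
  then obtain D z where Dz: "\<And>b. b \<in> B \<Longrightarrow> 0 < (D b :: real)"
      "\<And>b a. b \<in> B \<Longrightarrow> a < r \<Longrightarrow> D b * b $ a = of_int (z b a)"
    by metis
  define k0 where "k0 = (\<Sum>b\<in>B. \<Sum>a<r. nat \<bar>z b a\<bar>)"
  have "\<bar>z b a\<bar> \<le> int k0" if "b \<in> B" "a < r" for a b
  proof -
    have "nat \<bar>z b a\<bar> \<le> (\<Sum>a<r. nat \<bar>z b a\<bar>)"
      using that by (intro member_le_sum) auto
    also have "\<dots> \<le> k0"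
      unfolding k0_def using that fin by (intro member_le_sum) auto
    finally show ?thesis by linarith
  qed
  then show thesis
    using that B(1,2) Dz by blast
qed

theorem theoremA:
  fixes Z :: "real mat" and r :: nat
  assumes "0 < r"
    and "Z \<in> carrier_mat r r"
    and "doubly_nonneg Z"
    and "\<forall>i < r. 0 < Z $$ (i, i)"
    and "rational_subspace r (mat_kernel Z)"
  shows "(\<exists>k0::nat. \<forall>k \<ge> k0. \<exists>W.
            exact_instance (2 * k * r) W \<and>
            is_optimal_dual_slack W (kron Z (all_ones (2 * k))) \<and>
            vec_span (2 * k * r) (optimal_cuts W) = mat_kernel (kron Z (all_ones (2 * k))))
       \<and> (\<forall>k::nat. k \<ge> 1 \<longrightarrow>
            vec_space.rank (2 * k * r) (kron Z (all_ones (2 * k))) = vec_space.rank r Z \<and>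
            (completely_positive (kron Z (all_ones (2 * k))) \<longleftrightarrow> completely_positive Z) \<and>
            (completely_positive Z \<longrightarrow> cp_rank (kron Z (all_ones (2 * k))) = cp_rank Z))"
proof (rule conjI)
  note Z = assms(2)
  have size: "2 * k * r = r * (2 * k)" for k
    by (rule mult.commute)
  show "\<forall>k::nat. k \<ge> 1 \<longrightarrow>
            vec_space.rank (2 * k * r) (kron Z (all_ones (2 * k))) = vec_space.rank r Z \<and>
            (completely_positive (kron Z (all_ones (2 * k))) \<longleftrightarrow> completely_positive Z) \<and>
            (completely_positive Z \<longrightarrow> cp_rank (kron Z (all_ones (2 * k))) = cp_rank Z)"
    unfolding size using rank_kron_all_ones[OF Z] completely_positive_kron_all_ones[OF Z] by simp
  obtain B D z k0 where B: "B \<subseteq> carrier_vec r" "vec_span r B = mat_kernel Z"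
    and D: "\<And>b. b \<in> B \<Longrightarrow> 0 < (D b :: real)"
    and z: "\<And>b a. b \<in> B \<Longrightarrow> a < r \<Longrightarrow> D b * b $ a = of_int (z b a)"
      "\<And>b a. b \<in> B \<Longrightarrow> a < r \<Longrightarrow> \<bar>z b a\<bar> \<le> int k0"
    using integral_multiples[OF assms(5)] by blast
  have "\<exists>W. exact_instance (r * (2 * k)) W \<and> is_optimal_dual_slack W (kron Z (all_ones (2 * k))) \<and>
      vec_span (r * (2 * k)) (optimal_cuts W) = mat_kernel (kron Z (all_ones (2 * k)))"
    if k: "max 1 k0 \<le> k" for k
  proof -
    let ?n = "r * (2 * k)" and ?M = "kron Z (all_ones (2 * k))"
    define W where "W = maxcut_of_slack ?M"
    have k1: "1 \<le> k" and m: "0 < 2 * k"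
      using k by auto
    have M: "?M \<in> carrier_mat ?n ?n"
      using kron_all_ones_carrier[OF Z m] .
    have n2: "2 \<le> ?n"
      using mult_le_mono[of 1 r 2 "2 * k"] k1 assms(1) by simp
    have nbr: "\<forall>i<?n. \<exists>j<?n. j \<noteq> i \<and> 0 < ?M $$ (i, j)"
    proof (intro allI impI)
      fix i assume i: "i < ?n"
      (* A second vertex of the block of i; the entry of the pair comes from the diagonal of Z. *)
      define j where "j = i div (2 * k) * (2 * k) + (if i mod (2 * k) = 0 then 1 else 0)"
      have div: "j div (2 * k) = i div (2 * k)" and mod: "j mod (2 * k) = (if i mod (2 * k) = 0 then 1 else 0)"
        using m by (auto simp: j_def)
      have j: "j < ?n"
        unfolding j_def using m div_block_less[OF i] by (intro block_index_less[of _ "i div (2 * k)"]) auto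
      have "j \<noteq> i"
        using mod by (auto split: if_splits)
      moreover have "0 < ?M $$ (i, j)"
        using i j div assms(4) div_block_less[OF i] by (simp add: kron_all_ones[OF Z m])
      ultimately show "\<exists>j<?n. j \<noteq> i \<and> 0 < ?M $$ (i, j)"
        using j by blast
    qed
    obtain x where x: "x \<in> sign_vecs ?n \<inter> mat_kernel ?M"
      using threshold_signs_in_sign_vecs balanced_signs_in_kernel[OF Z k1] by blast
    then have "x \<in> sign_vecs ?n" "?M *\<^sub>v x = 0\<^sub>v ?n"
      using mat_kernelD(2)[OF M] by auto
    note realise = maxcut_of_slack_realises[OF n2 M doubly_nonneg_kron_all_ones[OF Z m assms(3)] nbr this]
    have "vec_span ?n (optimal_cuts W) = mat_kernel ?M"
      unfolding W_def realise(3) using z(1) order_trans[OF z(2), of _ _ "int k"] k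
      by (intro span_kernel_signs[OF Z k1 B D, where z = z]) auto
    then show ?thesis
      using realise(1,2) by (auto simp: W_def)
  qed
  then show "\<exists>k0::nat. \<forall>k \<ge> k0. \<exists>W.
            exact_instance (2 * k * r) W \<and>
            is_optimal_dual_slack W (kron Z (all_ones (2 * k))) \<and>
            vec_span (2 * k * r) (optimal_cuts W) = mat_kernel (kron Z (all_ones (2 * k)))"
    unfolding size by blast
qed

end
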